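(* Let $n \ge 1$ be an integer, let $\mathcal{F}$ be the set of all partial orders on $[n]=\{1,\dots,n\}$, and let $\mathcal{G}\subseteq\mathcal{F}$ be the set of all total orders on $[n]$. Regard $\mathcal{F}$ as a family of subsets of the ground set $\mathcal{G}$ by identifying each $A\in\mathcal{F}$ with the set $\{B\in\mathcal{G} : B \text{ is compatible with } A\}$. Then the VC-dimension $\mathrm{VC}_{\mathcal{G}}(\mathcal{F})$ of this set family satisfies \[ \mathrm{VC}_{\mathcal{G}}(\mathcal{F}) = \begin{cases} 3, & n=3,\\ \left\lfloor \frac{n^2}{4}\right\rfloor, & n\neq 3.\end{cases} \]
   Context: Two partial orders $<_1,<_2$ on $[n]$ are called compatible if there exists a partial order on $[n]$ finer than both (i.e. containing both relations), equivalently if the directed graph on $[n]$ whose edge set is $<_1\cup<_2$ (an edge $a\to b$ whenever $a<_1 b$ or $a<_2 b$) is acyclic. The empty relation counts as a partial order. For a family $\mathcal{H}$ of subsets of a set $X$, a subset $S\subseteq X$ is shattered by $\mathcal{H}$ if for every $A\subseteq S$ there is $B\in\mathcal{H}$ with $B\cap S=A$; the VC-dimension of $\mathcal{H}$ on $X$ is the largest cardinality of a subset of $X$ shattered by $\mathcal{H}$. Here $\mathrm{VC}_{\mathcal{G}}(\mathcal{F})$ denotes the VC-dimension of the family $\{\{B\in\mathcal{G}: B \text{ compatible with } A\} : A\in\mathcal{F}\}$ on the ground set $\mathcal{G}$. *)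

theory Defs
  imports Main "HOL-Library.Extended_Nat"
begin

(* Orders are strict (irreflexive), so the empty relation is a partial order; the library's
   partial_order_on is reflexive. *)

definition strict_partial_order_on :: "'a set \<Rightarrow> 'a rel \<Rightarrow> bool" where
  "strict_partial_order_on X r \<longleftrightarrow> r \<subseteq> X \<times> X \<and> irrefl r \<and> trans r"

definition partial_orders :: "nat \<Rightarrow> nat rel set" where
  "partial_orders n = {r. strict_partial_order_on {1..n} r}"

definition total_orders :: "nat \<Rightarrow> nat rel set" where
  "total_orders n = {r \<in> partial_orders n. total_on {1..n} r}"

definition compatible :: "nat \<Rightarrow> nat rel \<Rightarrow> nat rel \<Rightarrow> bool" where
  "compatible n r s \<longleftrightarrow> (\<exists>t \<in> partial_orders n. r \<subseteq> t \<and> s \<subseteq> t)"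

lemma compatible_iff_acyclic:
  assumes "r \<in> partial_orders n" "s \<in> partial_orders n"
  shows "compatible n r s \<longleftrightarrow> acyclic (r \<union> s)"
proof
  assume "compatible n r s"
  then obtain t where t: "irrefl t" "trans t" "r \<union> s \<subseteq> t"
    by (auto simp: compatible_def partial_orders_def strict_partial_order_on_def)
  then have "acyclic t"
    by (simp add: acyclic_irrefl)
  then show "acyclic (r \<union> s)"
    using t(3) by (rule acyclic_subset)
next
  assume "acyclic (r \<union> s)"
  moreover have "(r \<union> s)\<^sup>+ \<subseteq> {1..n} \<times> {1..n}"
    using assms by (intro trancl_subset_Sigma)
      (auto simp: partial_orders_def strict_partial_order_on_def)
  ultimately have "(r \<union> s)\<^sup>+ \<in> partial_orders n"
    by (simp add: partial_orders_def strict_partial_order_on_def acyclic_irrefl)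
  then show "compatible n r s"
    unfolding compatible_def by (intro bexI[of _ "(r \<union> s)\<^sup>+"]) auto
qed

definition shatters :: "'a set set \<Rightarrow> 'a set \<Rightarrow> bool" where
  "shatters H S \<longleftrightarrow> (\<forall>A. A \<subseteq> S \<longrightarrow> (\<exists>B \<in> H. B \<inter> S = A))"

(* The supremum is taken in enat: it is the largest cardinality of a shattered subset of X when the
   cardinalities are bounded, and infinity otherwise. *)

definition vc_dim :: "'a set \<Rightarrow> 'a set set \<Rightarrow> enat" where
  "vc_dim X H = (SUP S \<in> {S. S \<subseteq> X \<and> finite S \<and> shatters H S}. enat (card S))"

definition compatible_family :: "nat \<Rightarrow> nat rel set set" where
  "compatible_family n = (\<lambda>A. {B \<in> total_orders n. compatible n B A}) ` partial_orders n"

end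

theory Submission
  imports Defs
begin

text \<open>
  A total order \<open>B\<close> is compatible with \<open>A\<close> iff \<open>A \<subseteq> B\<close>. Hence a set of total orders is shattered iff
  the empty subset is cut out and every \<open>L\<close> in it misses a pair that all the others contain. These
  pairs form a digraph that becomes acyclic whenever one of its edges is reversed. Such a digraph is
  either a single directed cycle, with at most \<open>n\<close> edges, or it is acyclic and has no transitive
  edge, so that it is triangle-free and Mantel's theorem bounds it by \<open>n\<^sup>2 div 4\<close>. The complete
  bipartite digraph, and the directed triangle for \<open>n = 3\<close>, attain the bound.
\<close>

section \<open>Digraphs that become acyclic when an edge is reversed\<close>

text \<open>Induction by deleting both ends of an edge: without triangles, every other vertex is
  adjacent to at most one end, so at most \<open>1 + card W\<close> edges disappear, exactly the
  growth of the bound. Asymmetry makes \<open>card E\<close> count undirected edges.\<close>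

lemma mantel:
  fixes E :: "'a rel"
  assumes "finite V" "E \<subseteq> V \<times> V" "asym E"
    and "\<And>a b c. (a, b) \<in> E \<union> E\<inverse> \<Longrightarrow> (b, c) \<in> E \<union> E\<inverse> \<Longrightarrow> (a, c) \<notin> E \<union> E\<inverse>"
  shows "card E \<le> (card V)\<^sup>2 div 4"
  using assms
proof (induction "card V" arbitrary: V E rule: less_induct)
  case less
  note tri = less.prems(4)
  have asymD: "(b, a) \<notin> E" if "(a, b) \<in> E" for a b
    using less.prems(3) that by (meson asymD)
  show ?case
  proof (cases "E = {}")
    case False
    then obtain x y where xy: "(x, y) \<in> E" by auto
    with asymD have "x \<noteq> y" by blast
    have xyV: "x \<in> V" "y \<in> V" using xy less.prems(2) by auto
    define W where "W = V - {x, y}"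
    have "card {x, y} \<le> card V"
      using xyV less.prems(1) by (intro card_mono) auto
    then have "card V \<ge> 2" using \<open>x \<noteq> y\<close> by simp
    have cW: "card W = card V - 2"
      using xyV \<open>x \<noteq> y\<close> less.prems(1) unfolding W_def by (subst card_Diff_subset) auto
    have finW: "finite W" using less.prems(1) W_def by simp
    let ?E = "E \<inter> W \<times> W"
    \<comment> \<open>\<open>f z\<close> is the only possible edge between \<open>z\<close> and the
      ends \<open>x\<close>, \<open>y\<close>. If there is none, the default \<open>(y, z)\<close>
      is no edge, which is harmless since only an inclusion is claimed.\<close>
    define f where "f z = (if (z, x) \<in> E then (z, x) else if (x, z) \<in> E then (x, z)
      else if (z, y) \<in> E then (z, y) else (y, z))" for z
    have sub: "E \<subseteq> ?E \<union> insert (x, y) (f ` W)"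
    proof (rule subsetI)
      fix e assume e: "e \<in> E"
      obtain a b where [simp]: "e = (a, b)" by (cases e)
      have ab: "a \<in> V" "b \<in> V" "a \<noteq> b" "(b, a) \<notin> E"
        using e less.prems(2) asymD by auto
      have no: "(z, y) \<notin> E \<and> (y, z) \<notin> E" if "(z, x) \<in> E \<or> (x, z) \<in> E" for z
        using tri[of z x y] that xy by auto
      have no': "(z, x) \<notin> E \<and> (x, z) \<notin> E" if "(z, y) \<in> E \<or> (y, z) \<in> E" for z
        using no that by blast
      consider "a \<in> W" "b \<in> W" | "a = x" "b = y" | "a = y" "b = x"
        | "a = x" "b \<in> W" | "a = y" "b \<in> W" | "b = x" "a \<in> W" | "b = y" "a \<in> W"
        using ab unfolding W_def by blast
      then show "e \<in> ?E \<union> insert (x, y) (f ` W)"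
      proof cases
        case 1 then show ?thesis using e by auto
      next
        case 2 then show ?thesis by auto
      next
        case 3 then show ?thesis using e xy asymD by auto
      next
        case 4
        then have "f b = e" using e ab unfolding f_def by auto
        then show ?thesis using 4 by blast
      next
        case 5
        then have "f b = e" using e ab no'[of b] unfolding f_def by auto
        then show ?thesis using 5 by blast
      next
        case 6
        then have "f a = e" using e unfolding f_def by auto
        then show ?thesis using 6 by blast
      next
        case 7
        then have "f a = e" using e ab no'[of a] unfolding f_def by auto
        then show ?thesis using 7 by blast
      qed
    qed
    have "card ?E \<le> (card W)\<^sup>2 div 4"
    proof (rule less.hyps)
      show "card W < card V" using cW \<open>card V \<ge> 2\<close> by simp
      show "asym ?E" using asymD by (intro asymI) auto
      show "(a, c) \<notin> ?E \<union> ?E\<inverse>" if "(a, b) \<in> ?E \<union> ?E\<inverse>" "(b, c) \<in> ?E \<union> ?E\<inverse>" for a b c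
        using tri[of a b c] that by auto
    qed (use finW in auto)
    moreover have "card E \<le> card ?E + (1 + card W)"
    proof -
      have "card E \<le> card (?E \<union> insert (x, y) (f ` W))"
        using finW by (intro card_mono sub) auto
      also have "\<dots> \<le> card ?E + card (insert (x, y) (f ` W))" by (rule card_Un_le)
      also have "card (insert (x, y) (f ` W)) \<le> 1 + card W"
        using card_insert_le_m1[of "1 + card W" "f ` W" "(x, y)"] card_image_le[OF finW, of f] by simp
      finally show ?thesis by simp
    qed
    moreover have "(card V)\<^sup>2 div 4 = (card W)\<^sup>2 div 4 + (1 + card W)"
    proof -
      obtain m where m: "card V = m + 2" "card W = m"
        using cW \<open>card V \<ge> 2\<close> by (metis add_diff_cancel_right' le_add_diff_inverse2)
      have "(m + 2)\<^sup>2 = m\<^sup>2 + (1 + m) * 4" by (simp add: power2_eq_square)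
      then show ?thesis using m by simp
    qed
    ultimately show ?thesis by linarith
  qed simp
qed

text \<open>A path from \<open>b\<close> to \<open>a\<close> that stops at its first visit to \<open>a\<close> uses no edge out of \<open>a\<close>.\<close>

lemma rtrancl_avoid_out_edge:
  assumes "(b, a) \<in> E\<^sup>*"
  shows "(b, a) \<in> (E - {(a, c)})\<^sup>*"
  using assms
proof (induction rule: converse_rtrancl_induct)
  case (step y z)
  then show ?case
    by (cases "y = a") (auto intro: converse_rtrancl_into_rtrancl)
qed simp

text \<open>No two edges leave the same vertex: given \<open>(a, b)\<close> and
  \<open>(a, c)\<close>, some cycle uses \<open>(a, b)\<close>, and its return path to
  \<open>a\<close> can be cut short to avoid \<open>(a, c)\<close>, so deleting
  \<open>(a, c)\<close> would leave a cycle. Hence \<open>fst\<close> injects \<open>E\<close> into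
  \<open>V\<close>.\<close>

lemma card_minimal_non_acyclic:
  fixes E :: "'a rel"
  assumes "finite V" "E \<subseteq> V \<times> V" "\<not> acyclic E"
    and minimal: "\<And>e. e \<in> E \<Longrightarrow> acyclic (E - {e})"
  shows "card E \<le> card V"
proof -
  have "inj_on fst E"
  proof (rule inj_onI, rule ccontr)
    fix p q assume pq: "p \<in> E" "q \<in> E" "fst p = fst q" "p \<noteq> q"
    then obtain a b c where [simp]: "p = (a, b)" "q = (a, c)" and "b \<noteq> c"
      by (metis prod.collapse)
    have "insert (a, b) (E - {(a, b)}) = E" using pq by auto
    then have "(b, a) \<in> (E - {(a, b)})\<^sup>*"
      using assms(3) minimal[OF pq(1)] acyclic_insert[of a b "E - {(a, b)}"] by auto
    then have "(b, a) \<in> E\<^sup>*" by (rule rtrancl_mono[THEN subsetD, rotated]) auto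
    then have "(b, a) \<in> (E - {(a, c)})\<^sup>*" by (rule rtrancl_avoid_out_edge)
    moreover have "(a, b) \<in> E - {(a, c)}" using pq \<open>b \<noteq> c\<close> by auto
    ultimately have "(a, a) \<in> (E - {(a, c)})\<^sup>+" by (rule rtrancl_into_trancl2[rotated])
    then show False using minimal[OF pq(2)] unfolding acyclic_def by auto
  qed
  then show ?thesis
    by (rule card_inj_on_le) (use assms in auto)
qed

text \<open>If \<open>E\<close> has a cycle, the hypothesis makes it minimal among cyclic digraphs.
  If not, a path from \<open>a\<close> over \<open>b\<close> to \<open>c\<close> beside an edge
  \<open>(a, c)\<close> would become a cycle once that edge is reversed, so \<open>E\<close> is
  triangle-free.\<close>

lemma card_edge_reversal_acyclic:
  fixes E :: "'a rel"
  assumes "finite V" "E \<subseteq> V \<times> V"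
    and rev: "\<And>x y. (x, y) \<in> E \<Longrightarrow> acyclic (insert (y, x) (E - {(x, y)}))"
  shows "card E \<le> max (card V) ((card V)\<^sup>2 div 4)"
proof (cases "acyclic E")
  case False
  have "acyclic (E - {e})" if "e \<in> E" for e
    using rev[of "fst e" "snd e"] that by (auto simp: acyclic_insert)
  then have "card E \<le> card V"
    by (rule card_minimal_non_acyclic[OF assms(1,2) False])
  then show ?thesis by simp
next
  case True
  have no2: False if "(a, b) \<in> E" "(b, a) \<in> E" for a b
    using True trancl_into_trancl[OF r_into_trancl[OF that(1)] that(2)] by (auto simp: acyclic_def)
  have no3: False if "(a, b) \<in> E" "(b, c) \<in> E" "(c, a) \<in> E" for a b c
    using True trancl_into_trancl[OF trancl_into_trancl[OF r_into_trancl[OF that(1)] that(2)] that(3)]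
    by (auto simp: acyclic_def)
  have notrans: False if "(a, b) \<in> E" "(b, c) \<in> E" "(a, c) \<in> E" for a b c
  proof -
    let ?E = "E - {(a, c)}"
    have "(a, b) \<in> ?E" "(b, c) \<in> ?E" using that no2 by auto
    then have "(a, c) \<in> ?E\<^sup>*" by (meson r_into_rtrancl rtrancl.rtrancl_into_rtrancl)
    then show False using rev[OF that(3)] by (simp add: acyclic_insert)
  qed
  have "card E \<le> (card V)\<^sup>2 div 4"
  proof (rule mantel[OF assms(1,2)])
    show "asym E" using no2 by (intro asymI) blast
    \<comment> \<open>Each orientation of a triangle is a directed cycle or has a transitive edge;
      the instances run through the labellings.\<close>
    show "(a, c) \<notin> E \<union> E\<inverse>" if "(a, b) \<in> E \<union> E\<inverse>" "(b, c) \<in> E \<union> E\<inverse>" for a b c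
      using that no3[of a b c] no3[of b a c] notrans[of a b c] notrans[of a c b] notrans[of b a c]
        notrans[of b c a] notrans[of c a b] notrans[of c b a] no3[of a c b]
      by blast
  qed
  then show ?thesis by linarith
qed

section \<open>Shattered sets of total orders\<close>

lemma total_orderD:
  assumes "L \<in> total_orders n"
  shows "L \<subseteq> {1..n} \<times> {1..n}" "irrefl L" "trans L" "acyclic L"
    and "\<And>x y. x \<in> {1..n} \<Longrightarrow> y \<in> {1..n} \<Longrightarrow> x \<noteq> y \<Longrightarrow> (x, y) \<notin> L \<Longrightarrow> (y, x) \<in> L"
proof -
  have L: "L \<subseteq> {1..n} \<times> {1..n}" "irrefl L" "trans L" "total_on {1..n} L"
    using assms by (simp_all add: total_orders_def partial_orders_def strict_partial_order_on_def)
  then show "L \<subseteq> {1..n} \<times> {1..n}" "irrefl L" "trans L" "acyclic L"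
    by (simp_all add: acyclic_irrefl)
  show "(y, x) \<in> L" if "x \<in> {1..n}" "y \<in> {1..n}" "x \<noteq> y" "(x, y) \<notin> L" for x y
    using that L(4) unfolding total_on_def by blast
qed

text \<open>A pair of \<open>A\<close> missing from the total order \<open>B\<close> occurs reversed
  in \<open>B\<close>, and no partial order contains both directions. Conversely \<open>B\<close> is
  itself the common extension.\<close>

lemma compatible_total_order_iff:
  assumes "B \<in> total_orders n" "A \<in> partial_orders n"
  shows "compatible n B A \<longleftrightarrow> A \<subseteq> B"
proof
  assume "compatible n B A"
  then obtain t where t: "irrefl t" "trans t" "B \<subseteq> t" "A \<subseteq> t"
    by (auto simp: compatible_def partial_orders_def strict_partial_order_on_def)
  show "A \<subseteq> B"
  proof (rule subrelI, rule ccontr)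
    fix x y assume xy: "(x, y) \<in> A" "(x, y) \<notin> B"
    then have "x \<in> {1..n}" "y \<in> {1..n}" "x \<noteq> y"
      using assms(2) by (auto simp: partial_orders_def strict_partial_order_on_def irrefl_def)
    with xy(2) have "(y, x) \<in> B" using total_orderD(5)[OF assms(1)] by blast
    then have "(x, x) \<in> t" using t xy(1) by (meson subsetD transD)
    then show False using t(1) by (auto simp: irrefl_def)
  qed
next
  assume "A \<subseteq> B"
  then show "compatible n B A"
    using assms(1) by (auto simp: compatible_def total_orders_def)
qed

lemma shatters_compatible_family_iff:
  assumes "S \<subseteq> total_orders n"
  shows "shatters (compatible_family n) S \<longleftrightarrow>
    (\<forall>T \<subseteq> S. \<exists>A \<in> partial_orders n. {L \<in> S. A \<subseteq> L} = T)"
proof -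
  have "{B \<in> total_orders n. compatible n B A} \<inter> S = {L \<in> S. A \<subseteq> L}" if "A \<in> partial_orders n" for A
    using assms that compatible_total_order_iff by blast
  then show ?thesis by (simp add: shatters_def compatible_family_def)
qed

lemma card_shattered_le:
  assumes S: "S \<subseteq> total_orders n" "finite S" "shatters (compatible_family n) S"
  shows "card S \<le> max n (n\<^sup>2 div 4)"
proof -
  have "\<exists>p. p \<in> {1..n} \<times> {1..n} \<and> fst p \<noteq> snd p \<and> (\<forall>M \<in> S. p \<in> M \<longleftrightarrow> M \<noteq> L)" if L: "L \<in> S" for L
  proof -
    obtain A where A: "A \<in> partial_orders n" "{M \<in> S. A \<subseteq> M} = S - {L}"
      using S(1,3) shatters_compatible_family_iff[of S n] by (meson Diff_subset)
    then have "\<not> A \<subseteq> L" using L by blast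
    then obtain p where p: "p \<in> A" "p \<notin> L" by blast
    have "p \<in> {1..n} \<times> {1..n}" "fst p \<noteq> snd p"
      using A(1) p(1)
      by (auto simp: partial_orders_def strict_partial_order_on_def irrefl_def)
    moreover have "p \<in> M \<longleftrightarrow> M \<noteq> L" if "M \<in> S" for M using A(2) p that by blast
    ultimately show ?thesis by blast
  qed
  then obtain p where p: "\<And>L. L \<in> S \<Longrightarrow> p L \<in> {1..n} \<times> {1..n}"
    "\<And>L. L \<in> S \<Longrightarrow> fst (p L) \<noteq> snd (p L)"
    "\<And>L M. L \<in> S \<Longrightarrow> M \<in> S \<Longrightarrow> p L \<in> M \<longleftrightarrow> M \<noteq> L"
    by metis
  have "inj_on p S" using p(3) by (intro inj_onI) metis
  then have "card S = card (p ` S)" by (simp add: card_image)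
  also have "\<dots> \<le> max (card {1..n}) ((card {1..n})\<^sup>2 div 4)"
  proof (rule card_edge_reversal_acyclic)
    show "p ` S \<subseteq> {1..n} \<times> {1..n}" using p(1) by blast
    fix x y assume "(x, y) \<in> p ` S"
    then obtain L where L: "L \<in> S" "p L = (x, y)" by auto
    have tot: "L \<in> total_orders n" using L(1) S(1) by blast
    have "(x, y) \<notin> L" "x \<noteq> y" "x \<in> {1..n}" "y \<in> {1..n}"
      using p(1)[OF L(1)] p(2)[OF L(1)] p(3)[OF L(1) L(1)] L(2) by auto
    then have "(y, x) \<in> L" using total_orderD(5)[OF tot] by blast
    moreover have "p ` S - {(x, y)} \<subseteq> L" using p(3) L by (auto simp flip: L(2))
    ultimately have "insert (y, x) (p ` S - {(x, y)}) \<subseteq> L" by blast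
    then show "acyclic (insert (y, x) (p ` S - {(x, y)}))"
      using acyclic_subset total_orderD(4)[OF tot] by blast
  qed simp
  finally show ?thesis by simp
qed

text \<open>For \<open>n \<le> 2\<close> the previous bound is not sharp: it ignores that a partial order contained in no
  member of \<open>S\<close> is needed.\<close>

lemma card_shattered_small:
  assumes n: "n \<le> 2" and S: "S \<subseteq> total_orders n" "shatters (compatible_family n) S"
  shows "card S \<le> n - 1"
proof -
  obtain A where A: "A \<in> partial_orders n" "{L \<in> S. A \<subseteq> L} = {}"
    using S shatters_compatible_family_iff[of S n] by (meson empty_subsetI)
  have AD: "A \<subseteq> {1..n} \<times> {1..n}" "irrefl A"
    using A(1) by (auto simp: partial_orders_def strict_partial_order_on_def)
  show ?thesis
  proof (cases "A = {}")
    case True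
    then show ?thesis using A(2) by auto
  next
    case False
    then obtain x y where xy: "(x, y) \<in> A" by auto
    then have xy': "x \<noteq> y" "x \<in> {1..n}" "y \<in> {1..n}" using AD by (auto simp: irrefl_def)
    with n have n2: "n = 2" and range: "{1..n} = {x, y}" by auto
    have "(y, x) \<notin> A"
      using A(1) xy AD by (auto simp: partial_orders_def strict_partial_order_on_def irrefl_def dest: transD)
    then have "A = {(x, y)}" using AD xy range by (auto simp: irrefl_def)
    \<comment> \<open>On two points the only total order missing \<open>(x, y)\<close> is its
      reversal, so \<open>S\<close> has at most one member.\<close>
    have "L = {(y, x)}" if "L \<in> S" for L
    proof -
      note L = total_orderD[OF subsetD[OF S(1) that]]
      have "(x, y) \<notin> L" using A(2) that \<open>A = {(x, y)}\<close> by auto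
      then show ?thesis using L(1,2) L(5)[of x y] xy' range by (auto simp: irrefl_def)
    qed
    then have "S \<subseteq> {{(y, x)}}" by blast
    then show ?thesis using n2 card_mono[of "{{(y, x)}}" S] by simp
  qed
qed

section \<open>Constructing shattered sets\<close>

text \<open>A nonempty \<open>T\<close> is cut out by its intersection: if \<open>L p\<close> is not
  in \<open>T\<close>, then all members of \<open>T\<close> contain \<open>p\<close>, but
  \<open>L p\<close> does not. The extra order \<open>M\<close> serves the empty
  \<open>T\<close>.\<close>

lemma shatters_indexed_total_orders:
  assumes L: "\<And>p. p \<in> P \<Longrightarrow> L p \<in> total_orders n"
    and iff: "\<And>p q. p \<in> P \<Longrightarrow> q \<in> P \<Longrightarrow> q \<in> L p \<longleftrightarrow> q \<noteq> p"
    and M: "M \<in> total_orders n" "M \<notin> L ` P"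
  shows "shatters (compatible_family n) (L ` P)" "card (L ` P) = card P"
proof -
  have sub: "L ` P \<subseteq> total_orders n" using L by blast
  show "shatters (compatible_family n) (L ` P)"
    unfolding shatters_compatible_family_iff[OF sub]
  proof (intro allI impI)
    fix T assume T: "T \<subseteq> L ` P"
    show "\<exists>A \<in> partial_orders n. {B \<in> L ` P. A \<subseteq> B} = T"
    proof (cases "T = {}")
      \<comment> \<open>The empty intersection is the universal relation, not a partial order.
        \<open>M\<close> replaces it, since distinct total orders never contain one another.\<close>
      case True
      have "\<not> M \<subseteq> B" if "B \<in> L ` P" for B
      proof
        assume "M \<subseteq> B"
        have B: "B \<in> total_orders n" using sub that by blast
        have "B \<subseteq> M"
          using compatible_total_order_iff[OF M(1), of B] compatible_total_order_iff[OF B, of M]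
            B M(1) \<open>M \<subseteq> B\<close> by (auto simp: total_orders_def compatible_def)
        then show False using \<open>M \<subseteq> B\<close> that M(2) by auto
      qed
      then show ?thesis using True M(1) by (intro bexI[of _ M]) (auto simp: total_orders_def)
    next
      case False
      then obtain B\<^sub>0 where B\<^sub>0: "B\<^sub>0 \<in> T" by blast
      have T': "irrefl B" "trans B" "B \<subseteq> {1..n} \<times> {1..n}" if "B \<in> T" for B
        using total_orderD(1-3)[of B n] that T sub by blast+
      have "\<Inter>T \<in> partial_orders n"
        unfolding partial_orders_def strict_partial_order_on_def
      proof (intro CollectI conjI)
        show "\<Inter>T \<subseteq> {1..n} \<times> {1..n}" using T'(3) B\<^sub>0 by blast
        show "irrefl (\<Inter>T)" using T'(1) B\<^sub>0 by (auto simp: irrefl_def)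
        show "trans (\<Inter>T)" using T'(2) by (intro transI) (auto dest: transD)
      qed
      moreover have "L p \<in> T" if "p \<in> P" "\<Inter>T \<subseteq> L p" for p
      proof (rule ccontr)
        assume "L p \<notin> T"
        then have "p \<in> B" if "B \<in> T" for B using iff \<open>p \<in> P\<close> T that by blast
        then have "p \<in> L p" using \<open>\<Inter>T \<subseteq> L p\<close> by blast
        then show False using iff \<open>p \<in> P\<close> by blast
      qed
      ultimately show ?thesis using T by (intro bexI[of _ "\<Inter>T"]) auto
    qed
  qed
  have "inj_on L P" using iff by (intro inj_onI) metis
  then show "card (L ` P) = card P" by (rule card_image)
qed

text \<open>Ranking by numeric keys turns membership of a pair into an inequality that arithmetic
  decides.\<close>

definition key_order :: "nat \<Rightarrow> (nat \<Rightarrow> nat) \<Rightarrow> nat rel" where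
  "key_order n f = {(a, b). a \<in> {1..n} \<and> b \<in> {1..n} \<and> f a < f b}"

lemma key_order_total:
  assumes "inj_on f {1..n}"
  shows "key_order n f \<in> total_orders n"
proof -
  have "strict_partial_order_on {1..n} (key_order n f)"
    by (auto simp: key_order_def strict_partial_order_on_def irrefl_def intro: transI)
  moreover have "total_on {1..n} (key_order n f)"
  proof (rule total_onI)
    fix x y assume xy: "x \<in> {1..n}" "y \<in> {1..n}" "x \<noteq> y"
    then have "f x \<noteq> f y" using assms by (meson inj_onD)
    then show "(x, y) \<in> key_order n f \<or> (y, x) \<in> key_order n f"
      using xy by (auto simp: key_order_def)
  qed
  ultimately show ?thesis by (simp add: total_orders_def partial_orders_def)
qed

lemma finite_total_order_set:
  assumes "S \<subseteq> total_orders n"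
  shows "finite S"
proof -
  have "S \<subseteq> Pow ({1..n} \<times> {1..n})" using assms total_orderD(1) by blast
  then show ?thesis by (rule finite_subset) simp
qed

lemma shattered_bipartite:
  "\<exists>S \<subseteq> total_orders n. shatters (compatible_family n) S \<and> card S = n\<^sup>2 div 4"
proof -
  define k where "k = n div 2"
  define P where "P = {1..k} \<times> {k<..n}"
  \<comment> \<open>The lower half keeps keys up to \<open>k\<close>, the upper half gets keys above
    \<open>n + 2\<close>, and the ends of \<open>p\<close> move between them in swapped order. Thus
    \<open>p\<close> is the only pair of \<open>P\<close> that is reversed.\<close>
  define f where "f p a = (if a = snd p then n + 1 else if a = fst p then n + 2
    else if a \<le> k then a else a + n + 2)" for p :: "nat \<times> nat" and a
  define L where "L p = key_order n (f p)" for p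
  have kn: "k \<le> n" by (simp add: k_def)
  have L: "L p \<in> total_orders n" if "p \<in> P" for p
    unfolding L_def using that kn
    by (intro key_order_total) (auto simp: inj_on_def f_def P_def split: if_splits)
  have iff: "q \<in> L p \<longleftrightarrow> q \<noteq> p" if "p \<in> P" "q \<in> P" for p q
  proof -
    obtain a b x y where [simp]: "q = (a, b)" "p = (x, y)" by (cases q, cases p)
    have "1 \<le> a" "a \<le> k" "k < b" "b \<le> n" "x \<le> k" "k < y" using that by (auto simp: P_def)
    then have "f p a = (if a = x then n + 2 else a)" "f p b = (if b = y then n + 1 else b + n + 2)"
      by (auto simp: f_def)
    then show ?thesis
      using \<open>1 \<le> a\<close> \<open>a \<le> k\<close> \<open>k < b\<close> \<open>b \<le> n\<close> by (simp add: L_def key_order_def)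
  qed
  have M: "key_order n id \<in> total_orders n" by (rule key_order_total) simp
  \<comment> \<open>The natural order contains all of \<open>P\<close>, whereas each
    \<open>L p\<close> misses \<open>p\<close>.\<close>
  have "P \<subseteq> key_order n id" using kn by (auto simp: P_def key_order_def)
  then have "key_order n id \<notin> L ` P" using iff by blast
  note S = shatters_indexed_total_orders[OF L iff M this]
  have "card P = k * (n - k)" by (simp add: P_def)
  also have "\<dots> = n\<^sup>2 div 4"
  proof (cases "even n")
    case True
    then obtain m where "n = 2 * m" by blast
    then show ?thesis by (simp add: k_def power2_eq_square)
  next
    case False
    then obtain m where m: "n = 2 * m + 1" by (rule oddE)
    have "n\<^sup>2 = 1 + 4 * (m * (m + 1))" by (simp add: m power2_eq_square)
    then have "n\<^sup>2 div 4 = m * (m + 1)" by simp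
    then show ?thesis by (simp add: k_def m)
  qed
  finally show ?thesis using S L by (intro exI[of _ "L ` P"]) auto
qed

lemma shattered_triangle:
  "\<exists>S \<subseteq> total_orders 3. shatters (compatible_family 3) S \<and> card S = 3"
proof -
  define P :: "nat rel" where "P = {(1, 2), (2, 3), (3, 1)}"
  \<comment> \<open>The order \<open>L p\<close> walks round the triangle starting at
    \<open>snd p\<close>, so it breaks the cycle exactly at the edge \<open>p\<close>. Adding 3
    keeps the subtraction from truncating.\<close>
  define f where "f p a = (a + 3 - snd p) mod 3" for p :: "nat \<times> nat" and a
  define L where "L p = key_order 3 (f p)" for p
  have three: "{1..3} = {1, 2, 3 :: nat}" by auto
  have L: "L p \<in> total_orders 3" if "p \<in> P" for p
    unfolding L_def using that
    by (intro key_order_total, unfold three) (auto simp: inj_on_def f_def P_def)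
  have iff: "q \<in> L p \<longleftrightarrow> q \<noteq> p" if "p \<in> P" "q \<in> P" for p q
    using that by (auto simp: L_def key_order_def f_def P_def)
  have M: "key_order 3 (\<lambda>a. 3 - a) \<in> total_orders 3"
    by (rule key_order_total) (auto simp: inj_on_def)
  \<comment> \<open>The decreasing order misses two edges of the triangle, but each
    \<open>L p\<close> misses only one.\<close>
  have "(1, 2) \<notin> key_order 3 (\<lambda>a. 3 - a)" "(2, 3) \<notin> key_order 3 (\<lambda>a. 3 - a)"
    by (auto simp: key_order_def)
  moreover have "(1, 2) \<in> L p \<or> (2, 3) \<in> L p" if "p \<in> P" for p
    using iff[OF that, of "(1, 2)"] iff[OF that, of "(2, 3)"] by (auto simp: P_def)
  ultimately have "key_order 3 (\<lambda>a. 3 - a) \<notin> L ` P" by auto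
  note S = shatters_indexed_total_orders[OF L iff M this]
  have "card P = 3" by (simp add: P_def)
  then show ?thesis using S L by (intro exI[of _ "L ` P"]) auto
qed

theorem theorem1:
  fixes n :: nat
  assumes "n \<ge> 1"
  shows "vc_dim (total_orders n) (compatible_family n) =
    enat (if n = 3 then 3 else n\<^sup>2 div 4)"
proof -
  let ?m = "if n = 3 then 3 else n\<^sup>2 div 4"
  have upper: "card S \<le> ?m"
    if S: "S \<subseteq> total_orders n" "finite S" "shatters (compatible_family n) S" for S
  proof -
    \<comment> \<open>The bound \<open>max n (n\<^sup>2 div 4)\<close> is 3 for \<open>n = 3\<close>
      and \<open>n\<^sup>2 div 4\<close> from \<open>n = 4\<close> on. For \<open>n\<close> equal to
      1 or 2 the bound \<open>n - 1\<close> agrees with \<open>n\<^sup>2 div 4\<close>.\<close>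
    consider "n = 1 \<or> n = 2" | "n = 3" | "n \<ge> 4" using assms by linarith
    then show ?thesis
    proof cases
      case 1
      then show ?thesis using card_shattered_small[OF _ S(1,3)] by auto
    next
      case 2
      then show ?thesis using card_shattered_le[OF S] by simp
    next
      case 3
      then have "n * 4 \<le> n\<^sup>2" by (simp add: power2_eq_square)
      then have "n \<le> n\<^sup>2 div 4" by simp
      then show ?thesis using card_shattered_le[OF S] 3 by simp
    qed
  qed
  obtain S where S: "S \<subseteq> total_orders n" "shatters (compatible_family n) S" "card S = ?m"
    using shattered_bipartite[of n] shattered_triangle by (cases "n = 3") auto
  show ?thesis
    unfolding vc_dim_def
  proof (rule antisym)
    show "(SUP S \<in> {S. S \<subseteq> total_orders n \<and> finite S \<and> shatters (compatible_family n) S}.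
        enat (card S)) \<le> enat ?m"
      using upper by (intro SUP_least) auto
    show "enat ?m \<le> (SUP S \<in> {S. S \<subseteq> total_orders n \<and> finite S \<and> shatters (compatible_family n) S}.
        enat (card S))"
      using S finite_total_order_set[OF S(1)] by (intro SUP_upper2[of S]) auto
  qed
qed

end
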